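(* Let $(\mu,P)$ be a time-homogeneous Markov chain on a countable state space $S$ (with $\sigma$-algebra $2^S$), and let $(A_1,B_1),\dots,(A_k,B_k)$ with $A_i,B_i\subseteq S$ be a Streett acceptance condition such that $$\mathsf P_\mu\Big(\bigcap_{i=1}^k\mathrm{Fin}(A_i)\cup\mathrm{Inf}(B_i)\Big)=1.$$ Then there exist: - $I\subseteq S$; - $V_0:S\to\mathbb R_{\ge0}$ with $\mu V_0=0$; - $J_i\subseteq I\setminus A_i$; - $V_i,W_i:S\to\mathbb R_{\ge0}$; - $U_i:S\to\mathbb N$ ($i=1,\dots,k$); such that, for every $i=1,\dots,k$: 1. $\forall s\notin A_i$: $PV_i(s)\le V_i(s)$; 2. $\forall s\in A_i$: $V_i(s)\ge1$; 3. $\exists\gamma_i>0\ \forall s\in J_i$: $V_i(s)\le1-\gamma_i$; 4. $\forall s\in I\setminus(B_i\cup J_i)$: $PW_i(s)\le W_i(s)$ and $W_i(s)>0$; 5. $\forall s\in I\cap(B_i\cup J_i)$: $W_i(s)=U_i(s)=0$; 6. $\forall r\in\mathbb R_{\ge0}\ \exists\varepsilon_r>0\ \forall s\in I\setminus(B_i\cup J_i)$: if $W_i(s)\le r$ then $P(s,\{s':U_i(s')<U_i(s)\})\ge\varepsilon_r$; 7. $\forall r\in\mathbb R_{\ge0}$: $U_i[\{s\in I:W_i(s)\le r\}]$ is a bounded subset of $\mathbb N$; and moreover $\forall s\in I$: $PV_0(s)\le V_0(s)$, and $\forall s\notin I$: $V_0(s)\ge1$.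
   Context: Setting. - $\mathsf P_\mu$ is the law on $S^\omega$ of the time-homogeneous Markov chain $(\Phi_n)$ with initial distribution $\mu$ and transition kernel $P$. - $\mathrm{Fin}(A)=\bigcup_{n}\bigcap_{m\ge n}\{\Phi_m\notin A\}$ and $\mathrm{Inf}(A)=\bigcap_n\bigcup_{m\ge n}\{\Phi_m\in A\}$. Notation. - $PV(s)=\sum_u V(u)P(s,\{u\})$ and $\mu V=\sum_s V(s)\mu(\{s\})$. - $U_i[X]$ is the image of $X$ under $U_i$. *)

theory Defs
  imports "HOL-Probability.Probability"
begin

text \<open>
  On a countable state space every probability measure on the power set is a pmf, so the
  initial distribution is a pmf and the transition kernel maps each state to a pmf.
  The law of the chain on \<open>S\<^sup>\<omega>\<close> (sequences \<open>nat \<Rightarrow> 'a\<close>) is the Ionescu-Tulcea limit of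
  these one-step kernels; \<open>emeasure_markov_law_cylinder\<close> below gives its values on cylinders.
\<close>

definition markov_step :: "'a pmf \<Rightarrow> ('a \<Rightarrow> 'a pmf) \<Rightarrow> nat \<Rightarrow> (nat \<Rightarrow> 'a) \<Rightarrow> 'a measure" where
  "markov_step \<mu> P n \<omega> = measure_pmf (case n of 0 \<Rightarrow> \<mu> | Suc m \<Rightarrow> P (\<omega> m))"

definition markov_law :: "'a pmf \<Rightarrow> ('a \<Rightarrow> 'a pmf) \<Rightarrow> (nat \<Rightarrow> 'a) measure" where
  "markov_law \<mu> P =
     projective_family.lim UNIV
       (Ionescu_Tulcea.CI (markov_step \<mu> P) (\<lambda>_. count_space UNIV)) (\<lambda>_. count_space UNIV)"

lemma Ionescu_Tulcea_markov_step:
  "Ionescu_Tulcea (markov_step \<mu> P) (\<lambda>_. count_space UNIV)"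
proof (rule Ionescu_Tulcea.intro)
  fix i
  show "markov_step \<mu> P i \<in>
      measurable (PiM {0..<i} (\<lambda>_. count_space UNIV)) (subprob_algebra (count_space UNIV))"
  proof (cases i)
    case 0
    have "measure_pmf \<mu> \<in> space (subprob_algebra (count_space UNIV))"
      by (simp add: space_subprob_algebra prob_space_imp_subprob_space prob_space_measure_pmf)
    then show ?thesis
      using 0 by (simp add: markov_step_def[abs_def])
  next
    case (Suc m)
    have 1: "(\<lambda>\<omega>. \<omega> m) \<in> measurable (PiM {0..<i} (\<lambda>_. count_space UNIV)) (count_space UNIV)"
      using Suc by (intro measurable_component_singleton) auto
    have 2: "(\<lambda>s. measure_pmf (P s)) \<in> measurable (count_space UNIV) (subprob_algebra (count_space UNIV))"
      by (simp add: space_subprob_algebra prob_space_imp_subprob_space prob_space_measure_pmf)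
    show ?thesis
      using measurable_compose[OF 1 2] Suc by (simp add: markov_step_def[abs_def])
  qed
next
  show "prob_space (markov_step \<mu> P i x)" for i x
    by (simp add: markov_step_def prob_space_measure_pmf)
qed

lemma sets_markov_law: "sets (markov_law \<mu> P) = sets (PiM UNIV (\<lambda>_. count_space UNIV))"
proof -
  interpret Ionescu_Tulcea "markov_step \<mu> P" "\<lambda>_. count_space UNIV"
    by (rule Ionescu_Tulcea_markov_step)
  show ?thesis by (simp add: markov_law_def)
qed

lemma space_markov_law: "space (markov_law \<mu> P) = UNIV"
  using sets_eq_imp_space_eq[OF sets_markov_law[of \<mu> P]] by (simp add: space_PiM)

lemma emeasure_markov_law_cylinder:
  "emeasure (markov_law \<mu> P) {\<omega>. \<forall>i\<le>n. \<omega> i = x i} =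
     ennreal (pmf \<mu> (x 0) * (\<Prod>i<n. pmf (P (x i)) (x (Suc i))))"
proof -
  let ?M = "\<lambda>_::nat. count_space (UNIV :: 'a set)"
  interpret Ionescu_Tulcea "markov_step \<mu> P" ?M
    by (rule Ionescu_Tulcea_markov_step)
  have sing: "{restrict x {0..<m}} \<in> sets (PiM {0..<m} ?M)" for m
  proof -
    have "{restrict x {0..<m}} = PiE {0..<m} (\<lambda>i. {x i})"
      by (auto simp: PiE_singleton[symmetric] restrict_def extensional_def PiE_iff fun_eq_iff)
    then show ?thesis by (auto intro!: sets_PiM_I_finite)
  qed
  have step: "emeasure (C 0 (Suc m) (\<lambda>_. undefined)) {restrict x {0..<Suc m}} =
      emeasure (C 0 m (\<lambda>_. undefined)) {restrict x {0..<m}} *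
      emeasure (markov_step \<mu> P m x) {x m}" for m
  proof -
    have u: "(\<lambda>_. undefined) \<in> space (PiM {0..<0} ?M)" by (simp add: space_PiM)
    have "emeasure (C 0 (Suc m) (\<lambda>_. undefined)) {restrict x {0..<Suc m}} =
        (\<integral>\<^sup>+\<omega>. emeasure (eP m \<omega>) {restrict x {0..<Suc m}} \<partial>C 0 m (\<lambda>_. undefined))"
      unfolding C.simps add_0
    proof (rule emeasure_bind[OF _ _ sing])
      show "space (C 0 m (\<lambda>_. undefined)) \<noteq> {}"
        using prob_space.not_empty[OF prob_space_C[OF u]] by simp
      show "eP m \<in> measurable (C 0 m (\<lambda>_. undefined)) (subprob_algebra (PiM {0..<Suc m} ?M))"
        using measurable_eP[of m] sets_C[OF u, of m] by (simp cong: measurable_cong_sets)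
    qed
    also have "\<dots> = (\<integral>\<^sup>+\<omega>. emeasure (markov_step \<mu> P m x) {x m} *
        indicator {restrict x {0..<m}} \<omega> \<partial>C 0 m (\<lambda>_. undefined))"
    proof (rule nn_integral_cong)
      fix \<omega> assume "\<omega> \<in> space (C 0 m (\<lambda>_. undefined))"
      then have \<omega>: "\<omega> \<in> space (PiM {0..<m} ?M)" using space_C[OF u, of m] by simp
      then have ext: "\<omega> \<in> extensional {0..<m}" by (simp add: space_PiM PiE_def)
      have upd: "fun_upd \<omega> m y = restrict x {0..<Suc m} \<longleftrightarrow> \<omega> = restrict x {0..<m} \<and> y = x m" for y
      proof
        assume eq: "fun_upd \<omega> m y = restrict x {0..<Suc m}"
        have "\<omega> j = restrict x {0..<m} j" for j
          using fun_cong[OF eq, of j] extensional_arb[OF ext, of j]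
          by (cases "j < m"; cases "j = m") auto
        then show "\<omega> = restrict x {0..<m} \<and> y = x m"
          using fun_cong[OF eq, of m] by auto
      qed (auto simp: fun_eq_iff)
      then have *: "fun_upd \<omega> m -` {restrict x {0..<Suc m}} \<inter> UNIV =
          (if \<omega> = restrict x {0..<m} then {x m} else {})"
        by auto
      have "markov_step \<mu> P m (restrict x {0..<m}) = markov_step \<mu> P m x"
        by (simp add: markov_step_def split: nat.split)
      then show "emeasure (eP m \<omega>) {restrict x {0..<Suc m}} =
          emeasure (markov_step \<mu> P m x) {x m} * indicator {restrict x {0..<m}} \<omega>"
        using emeasure_eP[OF \<omega> sing[of "Suc m"]] * by (auto split: if_splits)
    qed
    also have "\<dots> = emeasure (markov_step \<mu> P m x) {x m} *
        emeasure (C 0 m (\<lambda>_. undefined)) {restrict x {0..<m}}"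
      using sing[of m] sets_C[OF u, of m] by (subst nn_integral_cmult_indicator) auto
    finally show ?thesis by (simp add: mult.commute)
  qed
  have C: "emeasure (C 0 (Suc m) (\<lambda>_. undefined)) {restrict x {0..<Suc m}} =
      ennreal (pmf \<mu> (x 0) * (\<Prod>i<m. pmf (P (x i)) (x (Suc i))))" for m
  proof (induction m)
    case 0
    have "emeasure (C 0 0 (\<lambda>_. undefined)) {restrict x {0..<0}} = 1"
      using sing[of 0] by (simp add: restrict_def)
    then show ?case
      by (subst step) (simp add: markov_step_def emeasure_pmf_single)
  next
    case (Suc m)
    have "emeasure (markov_step \<mu> P (Suc m) x) {x (Suc m)} = ennreal (pmf (P (x m)) (x (Suc m)))"
      by (simp add: markov_step_def emeasure_pmf_single)
    then show ?case
      unfolding step[of "Suc m"] Suc.IH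
      by (simp add: ennreal_mult''[symmetric] mult.assoc)
  qed
  have "{\<omega>. \<forall>i\<le>n. \<omega> i = x i} = prod_emb UNIV ?M {0..<Suc n} {restrict x {0..<Suc n}}"
    by (auto simp: prod_emb_def restrict_def fun_eq_iff less_Suc_eq_le; metis)
  then have "emeasure (markov_law \<mu> P) {\<omega>. \<forall>i\<le>n. \<omega> i = x i} =
      emeasure (CI {0..<Suc n}) {restrict x {0..<Suc n}}"
    using lim[OF _ sing[of "Suc n"]] by (simp add: markov_law_def)
  also have "\<dots> = emeasure (C 0 (Suc n) (\<lambda>_. undefined)) {restrict x {0..<Suc n}}"
    using emeasure_CI[of "{0..<Suc n}" "Suc n", OF _ sing[of "Suc n"]]
    by (simp add: prod_emb_id[of "{restrict x {0..<Suc n}}"] del: C.simps)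
  finally show ?thesis using C by simp
qed

lemma prob_space_markov_law: "prob_space (markov_law \<mu> P)"
proof -
  interpret Ionescu_Tulcea "markov_step \<mu> P" "\<lambda>_. count_space UNIV"
    by (rule Ionescu_Tulcea_markov_step)
  have "emeasure (markov_law \<mu> P) (prod_emb UNIV (\<lambda>_. count_space UNIV) {} {\<lambda>_. undefined}) =
      emeasure (CI {}) {\<lambda>_. undefined}"
    unfolding markov_law_def by (rule lim) (auto simp: sets_PiM_empty)
  also have "\<dots> = 1"
    using prob_space.emeasure_space_1[OF PF.prob_space_P[of "{}"]] by (simp add: CI_def space_PiM)
  finally show ?thesis
    by (intro prob_spaceI) (simp add: space_markov_law prod_emb_def restrict_def space_PiM)
qed

definition fin_often :: "'a set \<Rightarrow> (nat \<Rightarrow> 'a) set" where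
  "fin_often A = (\<Union>n. \<Inter>m\<in>{n..}. {\<omega>. \<omega> m \<notin> A})"

definition inf_often :: "'a set \<Rightarrow> (nat \<Rightarrow> 'a) set" where
  "inf_often A = (\<Inter>n. \<Union>m\<in>{n..}. {\<omega>. \<omega> m \<in> A})"

text \<open>
  \<open>PV(s)\<close> is \<open>pmf_sum (P s) V\<close> and \<open>\<mu>V\<close> is \<open>pmf_sum \<mu> V\<close>, for nonnegative \<open>V\<close>.  The sum is taken in
  \<open>[0,\<infinity>]\<close>, so that a divergent sum is \<open>\<infinity>\<close> and not the junk value \<open>0\<close> of a real-valued sum.
\<close>

definition pmf_sum :: "'a pmf \<Rightarrow> ('a \<Rightarrow> real) \<Rightarrow> ennreal" where
  "pmf_sum p V = (\<Sum>\<^sub>\<infinity>u. ennreal (V u) * ennreal (pmf p u))"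

lemma pmf_sum_eq_nn_integral: "pmf_sum p V = (\<integral>\<^sup>+u. ennreal (V u) \<partial>measure_pmf p)"
proof -
  define f where "f u = ennreal (V u) * ennreal (pmf p u)" for u
  have int: "(\<integral>\<^sup>+u. ennreal (V u) \<partial>measure_pmf p) = (\<integral>\<^sup>+u. f u \<partial>count_space UNIV)"
    by (simp add: nn_integral_measure_pmf f_def mult.commute)
  have fin: "(\<integral>\<^sup>+u. f u * indicator F u \<partial>count_space UNIV) = sum f F" if "finite F" for F
    using that by (subst nn_integral_count_space'[of F])
      (auto split: split_indicator)
  define F where "F n = from_nat_into (set_pmf p) ` {..n}" for n :: nat
  have "mono F" by (auto simp: F_def mono_def)
  have f_eq: "f u = (SUP n. f u * indicator (F n) u)" for u
  proof (rule antisym)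
    show "f u \<le> (SUP n. f u * indicator (F n) u)"
    proof (cases "u \<in> set_pmf p")
      case True
      then obtain n where "u = from_nat_into (set_pmf p) n"
        using from_nat_into_surj[OF countable_set_pmf] by metis
      then have "u \<in> F n" by (simp add: F_def)
      then show ?thesis by (intro SUP_upper2[of n]) auto
    next
      case False
      then show ?thesis by (simp add: f_def set_pmf_iff)
    qed
  qed (auto intro!: SUP_least split: split_indicator)
  have "(\<integral>\<^sup>+u. f u \<partial>count_space UNIV) = (\<integral>\<^sup>+u. (SUP n. f u * indicator (F n) u) \<partial>count_space UNIV)"
    using f_eq by simp
  also have "\<dots> = (SUP n. \<integral>\<^sup>+u. f u * indicator (F n) u \<partial>count_space UNIV)"
    using \<open>mono F\<close>
    by (intro nn_integral_monotone_convergence_SUP)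
       (auto simp: incseq_def le_fun_def mono_def split: split_indicator)
  also have "\<dots> = (SUP n. sum f (F n))"
    by (simp add: fin F_def)
  also have "\<dots> \<le> (SUP G\<in>{G. finite G \<and> G \<subseteq> UNIV}. sum f G)"
    by (rule SUP_least) (rule SUP_upper, simp add: F_def)
  finally have "(\<integral>\<^sup>+u. f u \<partial>count_space UNIV) \<le> (SUP G\<in>{G. finite G \<and> G \<subseteq> UNIV}. sum f G)" .
  moreover have "(SUP G\<in>{G. finite G \<and> G \<subseteq> UNIV}. sum f G) \<le> (\<integral>\<^sup>+u. f u \<partial>count_space UNIV)"
    by (rule SUP_least) (auto simp: fin[symmetric] intro!: nn_integral_mono split: split_indicator)
  ultimately show ?thesis
    unfolding pmf_sum_def f_def[symmetric] int by (simp add: nonneg_infsum_complete)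
qed

end

theory Submission
  imports Defs
begin

text \<open>
  Take \<open>I\<close> to be the set of reachable states and \<open>V\<^sub>0\<close> the indicator of its complement.  For one pair
  \<open>(A, B)\<close>, let \<open>V\<close> be the probability of hitting \<open>A\<close>, and let \<open>J\<close> be the states of \<open>I\<close> where
  \<open>V \<le> 1/2\<close>.  A run that avoids \<open>C = B \<union> J\<close> visits \<open>A\<close> only finitely often, hence from some time
  on avoids \<open>A \<union> C\<close>; but outside \<open>C\<close> the set \<open>A\<close> is hit with probability at least \<open>1/2\<close>, so this
  has probability \<open>0\<close>.  Thus \<open>C\<close> is hit almost surely from every state of \<open>I\<close>, which yields a
  supermartingale \<open>W\<close> with finite sublevel sets on \<open>I - C\<close>.  With \<open>U\<close> the length of a shortest
  path to \<open>C\<close>, the uniformity conditions on \<open>U\<close> hold because these sublevel sets are finite.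
\<close>

section \<open>Hitting and avoidance probabilities\<close>

text \<open>
  \<open>hit P R C s\<close> is the probability, from \<open>s\<close>, of visiting \<open>R\<close> before visiting \<open>C - R\<close>;
  \<open>avoid_upto P D n s\<close> is that of staying outside \<open>D\<close> at the \<open>n\<close> times \<open>0, \<dots>, n - 1\<close>.
\<close>

definition until_step :: "('s \<Rightarrow> 's pmf) \<Rightarrow> 's set \<Rightarrow> 's set \<Rightarrow> ('s \<Rightarrow> ennreal) \<Rightarrow> 's \<Rightarrow> ennreal" where
  "until_step P R C f s =
     (if s \<in> R then 1 else if s \<in> C then 0 else \<integral>\<^sup>+u. f u \<partial>measure_pmf (P s))"

definition hit_within :: "('s \<Rightarrow> 's pmf) \<Rightarrow> 's set \<Rightarrow> 's set \<Rightarrow> nat \<Rightarrow> 's \<Rightarrow> ennreal" where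
  "hit_within P R C n = (until_step P R C ^^ n) (\<lambda>_. 0)"

definition hit :: "('s \<Rightarrow> 's pmf) \<Rightarrow> 's set \<Rightarrow> 's set \<Rightarrow> 's \<Rightarrow> ennreal" where
  "hit P R C s = (SUP n. hit_within P R C n s)"

definition avoid_upto :: "('s \<Rightarrow> 's pmf) \<Rightarrow> 's set \<Rightarrow> nat \<Rightarrow> 's \<Rightarrow> ennreal" where
  "avoid_upto P D n = (until_step P {} D ^^ n) (\<lambda>_. 1)"

definition avoid :: "('s \<Rightarrow> 's pmf) \<Rightarrow> 's set \<Rightarrow> 's \<Rightarrow> ennreal" where
  "avoid P D s = (INF n. avoid_upto P D n s)"

lemma until_step_mono: "(\<And>u. f u \<le> g u) \<Longrightarrow> until_step P R C f s \<le> until_step P R C g s"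
  by (auto simp: until_step_def intro: nn_integral_mono)

lemma nn_integral_pmf_le_1: "(\<And>u. f u \<le> 1) \<Longrightarrow> (\<integral>\<^sup>+u. f u \<partial>measure_pmf p) \<le> (1 :: ennreal)"
  using nn_integral_mono[of "measure_pmf p" f "\<lambda>_. 1"] by simp

lemma until_step_le_1: "(\<And>u. f u \<le> 1) \<Longrightarrow> until_step P R C f s \<le> 1"
  by (auto simp: until_step_def intro: nn_integral_pmf_le_1)

lemma hit_within_0 [simp]: "hit_within P R C 0 s = 0"
  by (simp add: hit_within_def)

lemma hit_within_Suc: "hit_within P R C (Suc n) s = until_step P R C (hit_within P R C n) s"
  by (simp add: hit_within_def)

lemma avoid_upto_0 [simp]: "avoid_upto P D 0 s = 1"
  by (simp add: avoid_upto_def)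

lemma avoid_upto_Suc: "avoid_upto P D (Suc n) s = until_step P {} D (avoid_upto P D n) s"
  by (simp add: avoid_upto_def)

lemma hit_within_le_1: "hit_within P R C n s \<le> 1"
  by (induction n arbitrary: s) (auto simp: hit_within_Suc intro: until_step_le_1)

lemma avoid_upto_le_1: "avoid_upto P D n s \<le> 1"
  by (induction n arbitrary: s) (auto simp: avoid_upto_Suc intro: until_step_le_1)

lemma hit_within_le_Suc: "hit_within P R C n s \<le> hit_within P R C (Suc n) s"
proof (induction n arbitrary: s)
  case (Suc n)
  then show ?case
    by (subst (1 2) hit_within_Suc) (rule until_step_mono)
qed simp

lemma hit_within_mono: "m \<le> n \<Longrightarrow> hit_within P R C m s \<le> hit_within P R C n s"
  by (rule lift_Suc_mono_le[of "\<lambda>n. hit_within P R C n s"]) (rule hit_within_le_Suc)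

lemma avoid_upto_Suc_le: "avoid_upto P D (Suc n) s \<le> avoid_upto P D n s"
proof (induction n arbitrary: s)
  case 0
  then show ?case using avoid_upto_le_1[of P D "Suc 0" s] by simp
next
  case (Suc n)
  then show ?case
    by (subst (1 2) avoid_upto_Suc) (rule until_step_mono)
qed

lemma hit_le_1: "hit P R C s \<le> 1"
  by (auto simp: hit_def intro: SUP_least hit_within_le_1)

text \<open>Monotone convergence moves the supremum over horizons through the integral. The values
  on \<open>R\<close>, on \<open>C\<close> and the harmonicity elsewhere are all read off this
  fixed-point equation.\<close>

lemma hit_eq: "hit P R C s = until_step P R C (hit P R C) s"
proof -
  have "hit P R C s = (SUP n. hit_within P R C (Suc n) s)"
    unfolding hit_def
    by (intro antisym SUP_mono) (use hit_within_le_Suc[of P R C _ s] in blast)+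
  also have "\<dots> = until_step P R C (hit P R C) s"
  proof (cases "s \<in> R \<or> s \<in> C")
    case False
    have "(\<integral>\<^sup>+u. hit P R C u \<partial>measure_pmf (P s)) =
        (SUP n. \<integral>\<^sup>+u. hit_within P R C n u \<partial>measure_pmf (P s))"
      unfolding hit_def
      by (intro nn_integral_monotone_convergence_SUP)
        (auto simp: incseq_def le_fun_def intro: hit_within_mono)
    then show ?thesis using False by (simp add: hit_within_Suc until_step_def)
  qed (auto simp: hit_within_Suc until_step_def)
  finally show ?thesis .
qed

text \<open>Multiplication by a finite constant is continuous, and a decreasing sequence tends to
  its infimum. For \<open>c = \<top>\<close> and positive \<open>f\<close> tending to
  \<open>0\<close> the equation fails.\<close>

lemma INF_cmult_ennreal_decseq:
  fixes f :: "nat \<Rightarrow> ennreal"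
  assumes "decseq f" "c < \<top>"
  shows "(INF n. c * f n) = c * (INF n. f n)"
proof (rule LIMSEQ_unique)
  show "(\<lambda>n. c * f n) \<longlonglongrightarrow> (INF n. c * f n)"
    using assms(1) by (intro LIMSEQ_INF) (auto simp: decseq_def intro: mult_left_mono)
  show "(\<lambda>n. c * f n) \<longlonglongrightarrow> c * (INF n. f n)"
    using assms by (intro ennreal_tendsto_cmult LIMSEQ_INF)
qed

lemma avoid_le_avoid_upto: "avoid P D s \<le> avoid_upto P D n s"
  by (auto simp: avoid_def intro: INF_lower)

text \<open>Decreasing monotone convergence applies because all integrals are at most
  \<open>1\<close>.\<close>

lemma avoid_le_until_step: "avoid P D s \<le> until_step P {} D (avoid P D) s"
proof (cases "s \<in> D")
  case True
  then show ?thesis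
    using avoid_le_avoid_upto[of P D s "Suc 0"] by (simp add: avoid_upto_Suc until_step_def)
next
  case False
  have fin: "(\<integral>\<^sup>+u. avoid_upto P D n u \<partial>measure_pmf (P s)) < \<infinity>" for n
    using nn_integral_pmf_le_1[of "avoid_upto P D n" "P s", OF avoid_upto_le_1]
    by (simp add: order_le_less_trans)
  have "(\<integral>\<^sup>+u. avoid P D u \<partial>measure_pmf (P s)) =
      (INF n. \<integral>\<^sup>+u. avoid_upto P D n u \<partial>measure_pmf (P s))"
    unfolding avoid_def
    by (intro nn_integral_monotone_convergence_INF_decseq[OF _ _ fin] decseq_SucI le_funI
        avoid_upto_Suc_le) auto
  also have "\<dots> = (INF n. avoid_upto P D (Suc n) s)"
    using False by (simp add: avoid_upto_Suc until_step_def)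
  also have "\<dots> \<ge> avoid P D s"
    by (rule INF_greatest) (rule avoid_le_avoid_upto)
  finally show ?thesis using False by (simp add: until_step_def)
qed

text \<open>At a common horizon the two events, staying outside \<open>A\<close> and visiting
  \<open>A\<close>, are disjoint.\<close>

lemma avoid_upto_add_hit_within_le_1: "avoid_upto P A n s + hit_within P A {} n s \<le> 1"
proof (induction n arbitrary: s)
  case (Suc n)
  then show ?case
    by (auto simp: avoid_upto_Suc hit_within_Suc until_step_def nn_integral_add[symmetric]
        intro: nn_integral_pmf_le_1)
qed simp

lemma avoid_add_hit_le_1: "avoid P A s + hit P A {} s \<le> 1"
proof -
  have "avoid P A s + hit P A {} s = (SUP n. avoid P A s + hit_within P A {} n s)"
    by (simp add: hit_def ennreal_SUP_add_right)
  also have "\<dots> \<le> 1"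
    by (intro SUP_least order_trans[OF add_right_mono[OF avoid_le_avoid_upto]
          avoid_upto_add_hit_within_le_1])
  finally show ?thesis .
qed

lemma avoid_upto_antimono_set: "A \<subseteq> D \<Longrightarrow> avoid_upto P D n s \<le> avoid_upto P A n s"
  by (induction n arbitrary: s)
    (auto simp: avoid_upto_Suc until_step_def intro!: nn_integral_mono)

lemma avoid_antimono_set: "A \<subseteq> D \<Longrightarrow> avoid P D s \<le> avoid P A s"
  unfolding avoid_def by (rule INF_mono') (rule avoid_upto_antimono_set)

text \<open>
  The avoidance probability \<open>a\<close> is harmonic outside \<open>D\<close>, so \<open>a \<le> 1/2\<close> improves to
  \<open>a \<le> 1/2 \<cdot> avoid_upto n\<close> for all \<open>n\<close>, that is \<open>a \<le> a/2\<close>.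
\<close>

lemma avoid_eq_0:
  assumes AD: "A \<subseteq> D" and D: "\<And>s. s \<notin> D \<Longrightarrow> ennreal (1/2) \<le> hit P A {} s"
  shows "avoid P D s = 0"
proof -
  have half: "avoid P D s \<le> ennreal (1/2) * avoid_upto P D n s" for n s
  proof (induction n arbitrary: s)
    case 0
    show ?case
    proof (cases "s \<in> D")
      case True
      then show ?thesis using avoid_le_until_step[of P D s] by (simp add: until_step_def)
    next
      case False
      have "avoid P A s + ennreal (1/2) \<le> 1"
        using avoid_add_hit_le_1[of P A s] D[OF False] by (meson add_left_mono order_trans)
      also have "1 = ennreal (1/2) + ennreal (1/2)"
        by (subst ennreal_plus[symmetric]) auto
      finally have "ennreal (1/2) + avoid P A s \<le> ennreal (1/2) + ennreal (1/2)"
        by (simp only: add.commute)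
      then have "avoid P A s \<le> ennreal (1/2)"
        unfolding ennreal_add_left_cancel_le by simp
      then show ?thesis using avoid_antimono_set[OF AD, of P s] by simp
    qed
  next
    case (Suc n)
    have "avoid P D s \<le> until_step P {} D (avoid P D) s"
      by (rule avoid_le_until_step)
    also have "\<dots> \<le> until_step P {} D (\<lambda>u. ennreal (1/2) * avoid_upto P D n u) s"
      by (rule until_step_mono) (rule Suc.IH)
    also have "\<dots> = ennreal (1/2) * avoid_upto P D (Suc n) s"
      by (simp add: avoid_upto_Suc until_step_def nn_integral_cmult)
    finally show ?case .
  qed
  have le: "avoid P D s \<le> ennreal (1/2) * avoid P D s"
  proof -
    have "avoid P D s \<le> (INF n. ennreal (1/2) * avoid_upto P D n s)"
      by (rule INF_greatest) (rule half)
    also have "\<dots> = ennreal (1/2) * avoid P D s"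
      unfolding avoid_def
      by (intro INF_cmult_ennreal_decseq decseq_SucI avoid_upto_Suc_le ennreal_less_top)
    finally show ?thesis .
  qed
  \<comment> \<open>Being at most half of itself forces a value to be \<open>0\<close> only if it is
    finite, hence the passage to a real \<open>r\<close>.\<close>
  obtain r where r: "avoid P D s = ennreal r" "0 \<le> r"
    using avoid_le_avoid_upto[of P D s 0] by (cases "avoid P D s") (auto simp: top_unique)
  then have "ennreal r \<le> ennreal (1/2 * r)"
    using le by (simp only: ennreal_mult'')
  then have "r \<le> 1/2 * r"
    using r(2) by (subst (asm) ennreal_le_iff) auto
  then show ?thesis using r by simp
qed

section \<open>Hitting probabilities of vanishing target sets\<close>

text \<open>A run that reaches \<open>R\<close> before \<open>C\<close>, but not during the first
  \<open>n\<close> times, stays outside \<open>C\<close> at those times.\<close>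

lemma hit_within_add_le:
  "hit_within P R C (n + m) s \<le> hit_within P R C n s + avoid_upto P C n s"
proof (induction n arbitrary: s)
  case 0
  then show ?case using hit_within_le_1[of P R C m s] by simp
next
  case (Suc n)
  have "(\<integral>\<^sup>+u. hit_within P R C (n + m) u \<partial>measure_pmf (P s)) \<le>
      (\<integral>\<^sup>+u. hit_within P R C n u + avoid_upto P C n u \<partial>measure_pmf (P s))"
    by (rule nn_integral_mono) (rule Suc.IH)
  then show ?case
    by (auto simp: hit_within_Suc avoid_upto_Suc until_step_def nn_integral_add)
qed

lemma hit_le_hit_within_add_avoid: "hit P R C s \<le> hit_within P R C n s + avoid_upto P C n s"
  unfolding hit_def
proof (rule SUP_least)
  fix m
  show "hit_within P R C m s \<le> hit_within P R C n s + avoid_upto P C n s"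
    using hit_within_mono[of m "n + m" P R C s] hit_within_add_le[of P R C n m s] by simp
qed

text \<open>The horizon \<open>N\<close> is fixed, so dominated convergence with bound
  \<open>1\<close> can be applied once per step.\<close>

lemma hit_within_tendsto_0:
  assumes R: "\<And>s. \<forall>\<^sub>F n in sequentially. s \<notin> R n"
  shows "(\<lambda>n. hit_within P (R n) C N s) \<longlonglongrightarrow> 0"
proof (induction N arbitrary: s)
  case (Suc N)
  have "(\<lambda>n. \<integral>\<^sup>+u. hit_within P (R n) C N u \<partial>measure_pmf (P s)) \<longlonglongrightarrow> (\<integral>\<^sup>+u. 0 \<partial>measure_pmf (P s))"
    by (rule nn_integral_dominated_convergence[where w="\<lambda>_. 1"])
      (auto simp: hit_within_le_1 Suc.IH)
  then have "(\<lambda>n. if s \<in> C then 0 else \<integral>\<^sup>+u. hit_within P (R n) C N u \<partial>measure_pmf (P s)) \<longlonglongrightarrow> 0"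
    by (cases "s \<in> C") simp_all
  moreover have "\<forall>\<^sub>F n in sequentially.
      (if s \<in> C then 0 else \<integral>\<^sup>+u. hit_within P (R n) C N u \<partial>measure_pmf (P s)) =
      hit_within P (R n) C (Suc N) s"
    using R[of s] by eventually_elim (simp add: hit_within_Suc until_step_def)
  ultimately show ?case by (rule Lim_transform_eventually)
qed simp

text \<open>The horizon \<open>N\<close> is chosen first, making avoidance of \<open>C\<close>
  unlikely; only then is \<open>n\<close> taken large for that \<open>N\<close>. Each contributes
  \<open>e/2\<close>.\<close>

lemma eventually_hit_le:
  assumes R: "\<And>s. \<forall>\<^sub>F n in sequentially. s \<notin> R n" and av: "avoid P C s = 0" and e: "0 < e"
  shows "\<forall>\<^sub>F n in sequentially. hit P (R n) C s \<le> ennreal e"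
proof -
  have "avoid P C s < ennreal (e/2)" using av e by simp
  then obtain N where N: "avoid_upto P C N s < ennreal (e/2)"
    unfolding avoid_def by (auto simp: INF_less_iff)
  have "\<forall>\<^sub>F n in sequentially. hit_within P (R n) C N s < ennreal (e/2)"
    using order_tendstoD(2)[OF hit_within_tendsto_0[OF R]] e by simp
  then show ?thesis
  proof eventually_elim
    case (elim n)
    have "hit P (R n) C s \<le> hit_within P (R n) C N s + avoid_upto P C N s"
      by (rule hit_le_hit_within_add_avoid)
    also have "\<dots> \<le> ennreal (e/2) + ennreal (e/2)"
      using elim N by (intro add_mono) auto
    also have "\<dots> = ennreal e" using e by (simp add: ennreal_plus[symmetric] del: ennreal_plus)
    finally show ?case .
  qed
qed

section \<open>The recurrence supermartingale\<close>

text \<open>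
  Hitting probabilities of ever smaller cofinite sets tend to \<open>0\<close> pointwise; summing a fast
  subsequence of them gives a supermartingale with finite sublevel sets.
\<close>

lemma recurrence_supermartingale:
  fixes P :: "'s::countable \<Rightarrow> 's pmf"
  assumes closed: "\<And>s. s \<in> I \<Longrightarrow> set_pmf (P s) \<subseteq> I" and av: "\<And>s. s \<in> I \<Longrightarrow> avoid P C s = 0"
  shows "\<exists>W :: 's \<Rightarrow> real. (\<forall>s. 0 \<le> W s) \<and>
      (\<forall>s\<in>I - C. pmf_sum (P s) W \<le> ennreal (W s)) \<and> (\<forall>s\<in>I - C. 0 < W s) \<and>
      (\<forall>s\<in>I \<inter> C. W s = 0) \<and> (\<forall>r. finite {s \<in> I - C. W s \<le> r})"
proof -
  \<comment> \<open>The sets \<open>R n\<close> are cofinite in \<open>I - C\<close> and decrease to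
    the empty set, and \<open>R 0 = I - C\<close>.\<close>
  define R where "R n = {s \<in> I - C. n \<le> to_nat s}" for n
  have evR: "\<forall>\<^sub>F n in sequentially. s \<notin> R n" for s
    using eventually_gt_at_top[of "to_nat s"] by eventually_elim (simp add: R_def)
  have fin: "finite {s :: 's. to_nat s < m}" for m
    using finite_imageD[of to_nat "{s :: 's. to_nat s < m}"]
    by (auto intro: finite_subset[of _ "{..<m}"] simp: inj_on_def)
  have "\<exists>n. \<forall>s\<in>{s\<in>I. to_nat s < j}. hit P (R n) C s \<le> ennreal ((1/2)^j)" for j
  proof -
    have "finite {s\<in>I. to_nat s < j}" using fin[of j] by (rule rev_finite_subset) auto
    then have "\<forall>\<^sub>F n in sequentially. \<forall>s\<in>{s\<in>I. to_nat s < j}. hit P (R n) C s \<le> ennreal ((1/2)^j)"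
      by (intro eventually_ball_finite) (auto intro: eventually_hit_le evR av)
    then show ?thesis by (auto simp: eventually_sequentially)
  qed
  \<comment> \<open>\<open>\<nu> j\<close> makes the hitting probability at most \<open>2^-j\<close>
    simultaneously at the finitely many states of \<open>I\<close> with code below
    \<open>j\<close>.\<close>
  then obtain \<nu> where \<nu>: "\<And>j s. s \<in> I \<Longrightarrow> to_nat s < j \<Longrightarrow> hit P (R (\<nu> j)) C s \<le> ennreal ((1/2)^j)"
    by (force dest: choice)
  \<comment> \<open>The extra summand for \<open>R 0\<close> equals \<open>1\<close> on
    \<open>I - C\<close> and secures positivity there.\<close>
  define w where "w s = hit P (R 0) C s + (\<Sum>j. hit P (R (\<nu> j)) C s)" for s
  have w_fin: "w s < \<infinity>" if "s \<in> I" for s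
  proof -
    \<comment> \<open>The terms with \<open>j \<le> to_nat s\<close> are bounded by
      \<open>1\<close>, the others by a geometric series.\<close>
    have "(\<Sum>j. hit P (R (\<nu> j)) C s) \<le>
        (\<Sum>j. ennreal ((if j \<in> {..to_nat s} then 1 else 0) + (1/2)^j))"
    proof (rule suminf_le)
      fix j
      show "hit P (R (\<nu> j)) C s \<le> ennreal ((if j \<in> {..to_nat s} then 1 else 0) + (1/2)^j)"
      proof (cases "j \<le> to_nat s")
        case True
        have "hit P (R (\<nu> j)) C s \<le> ennreal 1" using hit_le_1[of P "R (\<nu> j)" C s] by simp
        also have "\<dots> \<le> ennreal (1 + (1/2)^j)" by (intro ennreal_leI) simp
        finally show ?thesis using True by simp
      qed (use \<nu>[OF that] in auto)
    qed auto
    also have "\<dots> < \<infinity>"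
    proof -
      have "summable (\<lambda>j. (if j \<in> {..to_nat s} then 1 else 0) + (1/2 :: real)^j)"
        by (intro summable_add summable_If_finite_set summable_geometric) auto
      then show ?thesis by (subst suminf_ennreal2) auto
    qed
    finally show ?thesis
      using order_le_less_trans[OF hit_le_1[of P "R 0" C s], of \<infinity>] by (simp add: w_def)
  qed
  \<comment> \<open>Finiteness of \<open>w\<close> is known only on \<open>I\<close>. As
    \<open>I\<close> is closed under \<open>P\<close>, the default \<open>0\<close> outside does not
    enter averages taken from \<open>I\<close>.\<close>
  define W where "W s = (if s \<in> I then enn2real (w s) else 0)" for s
  have ennW: "ennreal (W s) = w s" if "s \<in> I" for s
    using w_fin[OF that] that by (simp add: W_def)
  have super: "pmf_sum (P s) W \<le> ennreal (W s)" if s: "s \<in> I - C" for s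
  proof -
    \<comment> \<open>Outside \<open>C\<close>, \<open>hit\<close> is harmonic off
      \<open>R n\<close>; on \<open>R n\<close> it is \<open>1\<close> and bounds every
      average.\<close>
    have h: "(\<integral>\<^sup>+u. hit P (R n) C u \<partial>measure_pmf (P s)) \<le> hit P (R n) C s" for n
      using s by (subst (2) hit_eq) (auto simp: until_step_def intro: nn_integral_pmf_le_1 hit_le_1)
    have "pmf_sum (P s) W = (\<integral>\<^sup>+u. w u \<partial>measure_pmf (P s))"
      unfolding pmf_sum_eq_nn_integral
      using closed[of s] s by (intro nn_integral_cong_AE) (auto simp: AE_measure_pmf_iff ennW)
    also have "\<dots> = (\<integral>\<^sup>+u. hit P (R 0) C u \<partial>measure_pmf (P s)) +
        (\<Sum>j. \<integral>\<^sup>+u. hit P (R (\<nu> j)) C u \<partial>measure_pmf (P s))"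
      by (simp add: w_def nn_integral_add nn_integral_suminf)
    also have "\<dots> \<le> w s"
      unfolding w_def by (intro add_mono suminf_le h) auto
    finally show ?thesis using s ennW by simp
  qed
  have hit1: "hit P (R n) C s = 1" if "s \<in> R n" for n s
    using that by (subst hit_eq) (simp add: until_step_def)
  have pos: "0 < W s" if s: "s \<in> I - C" for s
  proof -
    have "hit P (R 0) C s = 1" using s by (intro hit1) (simp add: R_def)
    then have "1 \<le> ennreal (W s)" using s by (simp add: ennW w_def)
    then show ?thesis by simp
  qed
  have zero: "W s = 0" if s: "s \<in> I \<inter> C" for s
  proof -
    have "hit P (R n) C s = 0" for n
      using s by (subst hit_eq) (simp add: until_step_def R_def)
    then show ?thesis by (simp add: W_def w_def)
  qed
  have sub: "finite {s \<in> I - C. W s \<le> r}" for r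
  proof -
    obtain m :: nat where m: "r < m" using reals_Archimedean2 by blast
    \<comment> \<open>A state of \<open>I - C\<close> with code at least \<open>M\<close> lies in
      \<open>R (\<nu> j)\<close> for all \<open>j < m\<close>. Then \<open>m\<close> summands equal
      \<open>1\<close>, so \<open>W s \<ge> m > r\<close>.\<close>
    define M where "M = Suc (Max (\<nu> ` {..<m} \<union> {0}))"
    have "to_nat s < M" if s: "s \<in> I - C" and W: "W s \<le> r" for s
    proof (rule ccontr)
      assume "\<not> to_nat s < M"
      moreover have "\<nu> j < M" if "j < m" for j
        using that by (auto simp: M_def less_Suc_eq_le intro!: Max_ge)
      ultimately have "s \<in> R (\<nu> j)" if "j < m" for j
        using s that by (fastforce simp: R_def)
      then have "(\<Sum>j<m. hit P (R (\<nu> j)) C s) = (\<Sum>j<m. 1)"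
        by (intro sum.cong) (auto simp: hit1)
      moreover have "(\<Sum>j<m. hit P (R (\<nu> j)) C s) \<le> (\<Sum>j. hit P (R (\<nu> j)) C s)"
        by (rule sum_le_suminf) auto
      ultimately have "of_nat m \<le> w s"
        by (simp add: w_def add_increasing)
      then have "ennreal (real m) \<le> ennreal (W s)"
        using s by (simp add: ennW ennreal_of_nat_eq_real_of_nat)
      then show False using m W pos[OF s] by (simp add: ennreal_le_iff)
    qed
    then show ?thesis by (intro finite_subset[OF _ fin[of M]]) auto
  qed
  have nonneg: "0 \<le> W s" for s
    by (simp add: W_def)
  show ?thesis
    by (intro exI[of _ W] conjI allI ballI nonneg super pos zero sub)
qed

section \<open>Distance to the target set\<close>

text \<open>
  The argument is \<open>Suc n\<close> because \<open>avoid_upto P C (Suc n) s < 1\<close> says that \<open>C\<close> can be reached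
  from \<open>s\<close> in at most \<open>n\<close> steps.
\<close>

definition steps_to :: "('s \<Rightarrow> 's pmf) \<Rightarrow> 's set \<Rightarrow> 's \<Rightarrow> nat" where
  "steps_to P C s = (LEAST n. avoid_upto P C (Suc n) s < 1)"

lemma steps_to_eq_0: "s \<in> C \<Longrightarrow> steps_to P C s = 0"
  unfolding steps_to_def by (rule Least_eq_0) (simp add: avoid_upto_Suc until_step_def)

text \<open>If the average over successors of the avoidance probability with one step less is below
  \<open>1\<close>, then so is the value at some successor, which is therefore closer to
  \<open>C\<close>.\<close>

lemma steps_to_decreases:
  assumes av: "avoid P C s = 0" and s: "s \<notin> C"
  shows "0 < measure_pmf.prob (P s) {u. steps_to P C u < steps_to P C s}"
proof -
  have "avoid P C s < 1" using av by simp
  then obtain n where "avoid_upto P C n s < 1" by (auto simp: avoid_def INF_less_iff)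
  then have "avoid_upto P C (Suc n) s < 1"
    by (rule order_le_less_trans[OF avoid_upto_Suc_le])
  then have less: "avoid_upto P C (Suc (steps_to P C s)) s < 1"
    unfolding steps_to_def by (rule LeastI)
  then have less': "(\<integral>\<^sup>+u. avoid_upto P C (steps_to P C s) u \<partial>measure_pmf (P s)) < 1"
    using s by (simp add: avoid_upto_Suc until_step_def)
  \<comment> \<open>Distance \<open>0\<close> is excluded: \<open>avoid_upto P C 0\<close> is
    constantly \<open>1\<close>, so its integral would be \<open>1\<close>.\<close>
  then obtain m where m: "steps_to P C s = Suc m" by (cases "steps_to P C s") auto
  have "\<exists>u\<in>set_pmf (P s). avoid_upto P C (Suc m) u < 1"
  proof (rule ccontr)
    assume "\<not> ?thesis"
    then have "(\<integral>\<^sup>+u. 1 \<partial>measure_pmf (P s)) \<le> (\<integral>\<^sup>+u. avoid_upto P C (Suc m) u \<partial>measure_pmf (P s))"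
      by (intro nn_integral_mono_AE) (auto simp: AE_measure_pmf_iff not_less)
    then show False using less' m by simp
  qed
  then obtain u where u: "u \<in> set_pmf (P s)" "avoid_upto P C (Suc m) u < 1" by blast
  from u(2) have "steps_to P C u \<le> m" unfolding steps_to_def by (rule Least_le)
  then have "u \<in> {u. steps_to P C u < steps_to P C s}" using m by simp
  then show ?thesis using u(1) by (rule measure_pmf_posI[rotated])
qed

section \<open>The path law\<close>

text \<open>The index set \<open>K\<close> covers finite horizons \<open>{..<N}\<close> and the
  infinite one \<open>UNIV\<close> together. The event is a countable intersection of conditions on
  single coordinates; coordinate \<open>n\<close> may carry both kinds.\<close>

lemma sets_cylinder_avoid:
  "{\<omega>. (\<forall>i\<le>n. \<omega> i = x i) \<and> (\<forall>j\<in>K. \<omega> (n + j) \<notin> D)} \<in> sets (markov_law \<mu> P)"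
proof -
  have comp: "{\<omega>. \<omega> i \<in> X} \<in> sets (markov_law \<mu> P)" for i X
  proof -
    have "(\<lambda>\<omega>. \<omega> i) \<in> measurable (markov_law \<mu> P) (count_space UNIV)"
      by (simp add: measurable_cong_sets[OF sets_markov_law refl])
    from measurable_sets[OF this, of X] show ?thesis
      by (simp add: space_markov_law vimage_def)
  qed
  have "{\<omega>. (\<forall>i\<le>n. \<omega> i = x i) \<and> (\<forall>j\<in>K. \<omega> (n + j) \<notin> D)} =
      (\<Inter>i. {\<omega>. \<omega> i \<in> (if i \<le> n then {x i} else UNIV) \<inter> (if n \<le> i \<and> i - n \<in> K then - D else UNIV)})"
    (is "?L = ?R")
  proof (intro set_eqI iffI)
    fix \<omega> assume "\<omega> \<in> ?L"
    then show "\<omega> \<in> ?R" by (auto dest: bspec[of K _ "_ - n"])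
  next
    fix \<omega> assume "\<omega> \<in> ?R"
    then have *: "\<omega> i \<in> (if i \<le> n then {x i} else UNIV) \<inter> (if n \<le> i \<and> i - n \<in> K then - D else UNIV)" for i
      by blast
    have "\<omega> i = x i" if "i \<le> n" for i using *[of i] that by simp
    moreover have "\<omega> (n + j) \<notin> D" if "j \<in> K" for j using *[of "n + j"] that by simp
    ultimately show "\<omega> \<in> ?L" by blast
  qed
  also have "\<dots> \<in> sets (markov_law \<mu> P)"
    by (intro sets.countable_INT comp image_subsetI) auto
  finally show ?thesis .
qed

text \<open>This is the Markov property at time \<open>n\<close>. The induction checks
  \<open>x n\<close> against \<open>D\<close>, then splits by the value \<open>y\<close> at time
  \<open>Suc n\<close>, which lengthens the cylinder and leaves one avoidance check less.\<close>

lemma emeasure_cylinder_avoid_upto: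
  fixes \<mu> :: "'s::countable pmf"
  shows "emeasure (markov_law \<mu> P) {\<omega>. (\<forall>i\<le>n. \<omega> i = x i) \<and> (\<forall>j<N. \<omega> (n + j) \<notin> D)} =
     emeasure (markov_law \<mu> P) {\<omega>. \<forall>i\<le>n. \<omega> i = x i} * avoid_upto P D N (x n)"
proof (induction N arbitrary: n x)
  case (Suc N)
  let ?M = "markov_law \<mu> P"
  define E where "E y = {\<omega>. (\<forall>i\<le>Suc n. \<omega> i = (x(Suc n := y)) i) \<and> (\<forall>j<N. \<omega> (Suc n + j) \<notin> D)}" for y
  have E: "E y \<in> sets ?M" for y
    using sets_cylinder_avoid[of "Suc n" "x(Suc n := y)" "{..<N}" D \<mu> P]
    by (simp add: E_def Ball_def del: fun_upd_apply)
  show ?case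
  proof (cases "x n \<in> D")
    case True
    then have "{\<omega>. (\<forall>i\<le>n. \<omega> i = x i) \<and> (\<forall>j<Suc N. \<omega> (n + j) \<notin> D)} = {}"
      by (simp add: set_eq_iff) (metis add_0_right le_refl zero_less_Suc)
    then show ?thesis using True by (simp only:) (simp add: avoid_upto_Suc until_step_def)
  next
    case False
    have cyl: "emeasure ?M {\<omega>. \<forall>i\<le>Suc n. \<omega> i = (x(Suc n := y)) i} =
        emeasure ?M {\<omega>. \<forall>i\<le>n. \<omega> i = x i} * ennreal (pmf (P (x n)) y)" for y
    proof -
      have "(\<Prod>i<n. pmf (P ((x(Suc n := y)) i)) ((x(Suc n := y)) (Suc i))) =
          (\<Prod>i<n. pmf (P (x i)) (x (Suc i)))"
        by (rule prod.cong) auto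
      then show ?thesis
        unfolding emeasure_markov_law_cylinder
        by (simp add: ennreal_mult''[symmetric] mult.assoc del: fun_upd_apply)
          (simp add: mult.assoc)
    qed
    have "{\<omega>. (\<forall>i\<le>n. \<omega> i = x i) \<and> (\<forall>j<Suc N. \<omega> (n + j) \<notin> D)} = (\<Union>y. E y)"
      using False by (auto simp: E_def le_Suc_eq All_less_Suc2)
    then have "emeasure ?M {\<omega>. (\<forall>i\<le>n. \<omega> i = x i) \<and> (\<forall>j<Suc N. \<omega> (n + j) \<notin> D)} =
        (\<integral>\<^sup>+y. emeasure ?M (E y) \<partial>count_space UNIV)"
      by (simp only:) (rule emeasure_UN_countable; use E in \<open>auto simp: E_def disjoint_family_on_def\<close>)
    also have "\<dots> = (\<integral>\<^sup>+y. emeasure ?M {\<omega>. \<forall>i\<le>n. \<omega> i = x i} *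
        (ennreal (pmf (P (x n)) y) * avoid_upto P D N y) \<partial>count_space UNIV)"
      unfolding E_def Suc.IH cyl by (simp add: mult.assoc)
    also have "\<dots> = emeasure ?M {\<omega>. \<forall>i\<le>n. \<omega> i = x i} * avoid_upto P D (Suc N) (x n)"
      using False by (simp add: nn_integral_cmult nn_integral_measure_pmf avoid_upto_Suc until_step_def)
    finally show ?thesis .
  qed
qed simp

text \<open>Continuity from above of the path law, as the horizon grows.\<close>

lemma emeasure_cylinder_avoid:
  fixes \<mu> :: "'s::countable pmf"
  shows "emeasure (markov_law \<mu> P) {\<omega>. (\<forall>i\<le>n. \<omega> i = x i) \<and> (\<forall>j. \<omega> (n + j) \<notin> D)} =
     emeasure (markov_law \<mu> P) {\<omega>. \<forall>i\<le>n. \<omega> i = x i} * avoid P D (x n)"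
proof -
  let ?M = "markov_law \<mu> P"
  interpret prob_space ?M by (rule prob_space_markov_law)
  define E where "E N = {\<omega>. (\<forall>i\<le>n. \<omega> i = x i) \<and> (\<forall>j<N. \<omega> (n + j) \<notin> D)}" for N :: nat
  have E: "E N \<in> sets ?M" for N
    using sets_cylinder_avoid[of n x "{..<N}" D \<mu> P] by (simp add: E_def Ball_def)
  have dec: "decseq E"
    by (rule decseq_SucI) (auto simp: E_def)
  have "{\<omega>. (\<forall>i\<le>n. \<omega> i = x i) \<and> (\<forall>j. \<omega> (n + j) \<notin> D)} = (\<Inter>N. E N)"
    by (auto simp: E_def)
  then have "emeasure ?M {\<omega>. (\<forall>i\<le>n. \<omega> i = x i) \<and> (\<forall>j. \<omega> (n + j) \<notin> D)} = (INF N. emeasure ?M (E N))"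
    using INF_emeasure_decseq[of E ?M] E by (simp add: image_subset_iff dec)
  also have "\<dots> = emeasure ?M {\<omega>. \<forall>i\<le>n. \<omega> i = x i} * avoid P D (x n)"
    unfolding E_def emeasure_cylinder_avoid_upto avoid_def
    by (intro INF_cmult_ennreal_decseq decseq_SucI avoid_upto_Suc_le)
      (simp add: less_top[symmetric])
  finally show ?thesis .
qed

text \<open>Reachability is phrased by cylinders of positive mass, so that a null path event can be
  divided by that mass to give a statement about the state.\<close>

definition reachable :: "'s pmf \<Rightarrow> ('s \<Rightarrow> 's pmf) \<Rightarrow> 's set" where
  "reachable \<mu> P = {x n | x n. emeasure (markov_law \<mu> P) {\<omega>. \<forall>i\<le>n. \<omega> i = x i} \<noteq> 0}"

lemma set_pmf_subset_reachable: "set_pmf \<mu> \<subseteq> reachable \<mu> P"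
proof
  fix s assume "s \<in> set_pmf \<mu>"
  then have "emeasure (markov_law \<mu> P) {\<omega>. \<forall>i\<le>0. \<omega> i = (\<lambda>_. s) i} \<noteq> 0"
    unfolding emeasure_markov_law_cylinder by (simp add: set_pmf_iff)
  then show "s \<in> reachable \<mu> P"
    unfolding reachable_def by (intro CollectI exI[of _ "\<lambda>_. s"] exI[of _ 0] conjI refl)
qed

lemma reachable_closed:
  assumes "s \<in> reachable \<mu> P" shows "set_pmf (P s) \<subseteq> reachable \<mu> P"
proof
  fix t assume t: "t \<in> set_pmf (P s)"
  obtain x n where s: "s = x n" and x: "emeasure (markov_law \<mu> P) {\<omega>. \<forall>i\<le>n. \<omega> i = x i} \<noteq> 0"
    using assms by (auto simp: reachable_def)
  define y where "y = x(Suc n := t)"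
  have "(\<Prod>i<n. pmf (P (y i)) (y (Suc i))) = (\<Prod>i<n. pmf (P (x i)) (x (Suc i)))"
    by (rule prod.cong) (auto simp: y_def)
  then have "emeasure (markov_law \<mu> P) {\<omega>. \<forall>i\<le>Suc n. \<omega> i = y i} =
      emeasure (markov_law \<mu> P) {\<omega>. \<forall>i\<le>n. \<omega> i = x i} * ennreal (pmf (P s) t)"
    unfolding emeasure_markov_law_cylinder
    by (simp add: ennreal_mult''[symmetric] mult.assoc) (simp add: y_def s mult.assoc)
  then have "emeasure (markov_law \<mu> P) {\<omega>. \<forall>i\<le>Suc n. \<omega> i = y i} \<noteq> 0"
    using x t by (simp add: set_pmf_iff)
  moreover have "y (Suc n) = t" by (simp add: y_def)
  ultimately show "t \<in> reachable \<mu> P" unfolding reachable_def by blast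
qed

lemma AE_not_eventually_avoid:
  fixes \<mu> :: "'s::countable pmf"
  assumes av: "\<And>s. avoid P D s = 0"
  shows "AE \<omega> in markov_law \<mu> P. \<exists>j. \<omega> (n + j) \<in> D"
proof -
  let ?M = "markov_law \<mu> P"
  \<comment> \<open>Prefixes are encoded as lists, since lists over \<open>'s\<close> are countable,
    whereas functions from \<open>nat\<close> need not be. Only the first \<open>n + 1\<close>
    entries matter.\<close>
  have "AE \<omega> in ?M. \<not> ((\<forall>i\<le>n. \<omega> i = xs ! i) \<and> (\<forall>j. \<omega> (n + j) \<notin> D))" for xs
  proof (rule AE_I[where N="{\<omega>. (\<forall>i\<le>n. \<omega> i = xs ! i) \<and> (\<forall>j. \<omega> (n + j) \<notin> D)}"])
    show "emeasure ?M {\<omega>. (\<forall>i\<le>n. \<omega> i = xs ! i) \<and> (\<forall>j. \<omega> (n + j) \<notin> D)} = 0"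
      unfolding emeasure_cylinder_avoid av by simp
    show "{\<omega>. (\<forall>i\<le>n. \<omega> i = xs ! i) \<and> (\<forall>j. \<omega> (n + j) \<notin> D)} \<in> sets ?M"
      using sets_cylinder_avoid[of n "(!) xs" UNIV D \<mu> P] by simp
  qed auto
  then have "AE \<omega> in ?M. \<forall>xs. \<not> ((\<forall>i\<le>n. \<omega> i = xs ! i) \<and> (\<forall>j. \<omega> (n + j) \<notin> D))"
    by (simp only: AE_all_countable) blast
  then show ?thesis
  proof eventually_elim
    case (elim \<omega>)
    have "\<forall>i\<le>n. \<omega> i = map \<omega> [0..<Suc n] ! i"
      by (auto simp: less_Suc_eq_le simp del: upt_Suc)
    then show ?case using elim by blast
  qed
qed

text \<open>Avoiding \<open>C\<close> from time \<open>n\<close> on excludes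
  \<open>inf_often B\<close>, hence forces eventual avoidance of \<open>A \<union> C\<close>, a null
  event. Within a cylinder ending at \<open>s\<close> its measure is the positive cylinder mass
  times \<open>avoid P C s\<close>.\<close>

lemma avoid_reachable_eq_0:
  fixes \<mu> :: "'s::countable pmf"
  assumes ae: "AE \<omega> in markov_law \<mu> P. \<omega> \<in> fin_often A \<union> inf_often B"
    and BC: "B \<subseteq> C" and C: "\<And>s. s \<notin> C \<Longrightarrow> ennreal (1/2) \<le> hit P A {} s"
    and s: "s \<in> reachable \<mu> P"
  shows "avoid P C s = 0"
proof -
  let ?M = "markov_law \<mu> P"
  obtain x n where sx: "s = x n" and x: "emeasure ?M {\<omega>. \<forall>i\<le>n. \<omega> i = x i} \<noteq> 0"
    using s by (auto simp: reachable_def)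
  have "avoid P (A \<union> C) t = 0" for t
    by (rule avoid_eq_0[where A=A]) (use C in auto)
  then have "AE \<omega> in ?M. \<forall>m. \<exists>j. \<omega> (m + j) \<in> A \<union> C"
    by (simp only: AE_all_countable) (intro allI AE_not_eventually_avoid)
  with ae have "AE \<omega> in ?M. \<not> ((\<forall>i\<le>n. \<omega> i = x i) \<and> (\<forall>j. \<omega> (n + j) \<notin> C))"
  proof eventually_elim
    case (elim \<omega>)
    show ?case
    proof
      assume *: "(\<forall>i\<le>n. \<omega> i = x i) \<and> (\<forall>j. \<omega> (n + j) \<notin> C)"
      then have nC: "\<omega> j \<notin> C" if "n \<le> j" for j
        using that le_iff_add by metis
      then have "\<omega> \<notin> inf_often B" using BC by (auto simp: inf_often_def)
      then obtain m where m: "\<And>j. m \<le> j \<Longrightarrow> \<omega> j \<notin> A"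
        using elim(1) by (auto simp: fin_often_def)
      obtain j where "\<omega> (max m n + j) \<in> A \<union> C" using elim(2) by blast
      then show False using m[of "max m n + j"] nC[of "max m n + j"] by auto
    qed
  qed
  moreover have "{\<omega>. (\<forall>i\<le>n. \<omega> i = x i) \<and> (\<forall>j. \<omega> (n + j) \<notin> C)} \<in> sets ?M"
    using sets_cylinder_avoid[of n x UNIV C \<mu> P] by simp
  ultimately have "emeasure ?M {\<omega>. (\<forall>i\<le>n. \<omega> i = x i) \<and> (\<forall>j. \<omega> (n + j) \<notin> C)} = 0"
    by (subst (asm) AE_iff_measurable[OF _ refl]) (auto simp: space_markov_law)
  then show ?thesis using x by (simp add: emeasure_cylinder_avoid sx)
qed

section \<open>Streett certificates\<close>

text \<open>Packaging the conditions for one pair lets the witnesses for all pairs be chosen at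
  once.\<close>

definition streett_certificate ::
    "('s \<Rightarrow> 's pmf) \<Rightarrow> 's set \<Rightarrow> 's set \<Rightarrow> 's set \<Rightarrow> 's set \<Rightarrow> ('s \<Rightarrow> real) \<Rightarrow> ('s \<Rightarrow> real) \<Rightarrow> ('s \<Rightarrow> nat) \<Rightarrow> bool"
  where
  "streett_certificate P I A B J V W U \<longleftrightarrow>
     J \<subseteq> I - A \<and>
     (\<forall>s. 0 \<le> V s) \<and> (\<forall>s. 0 \<le> W s) \<and>
     (\<forall>s. s \<notin> A \<longrightarrow> pmf_sum (P s) V \<le> ennreal (V s)) \<and>
     (\<forall>s\<in>A. 1 \<le> V s) \<and>
     (\<exists>\<gamma>>0. \<forall>s\<in>J. V s \<le> 1 - \<gamma>) \<and>
     (\<forall>s\<in>I - (B \<union> J). pmf_sum (P s) W \<le> ennreal (W s) \<and> 0 < W s) \<and>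
     (\<forall>s\<in>I \<inter> (B \<union> J). W s = 0 \<and> U s = 0) \<and>
     (\<forall>r\<ge>0. \<exists>\<epsilon>>0. \<forall>s\<in>I - (B \<union> J).
        W s \<le> r \<longrightarrow> \<epsilon> \<le> measure_pmf.prob (P s) {s'. U s' < U s}) \<and>
     (\<forall>r\<ge>0. bdd_above (U ` {s \<in> I. W s \<le> r}))"

lemma ex_streett_certificate:
  fixes \<mu> :: "'s::countable pmf" and P :: "'s \<Rightarrow> 's pmf"
  assumes ae: "AE \<omega> in markov_law \<mu> P. \<omega> \<in> fin_often A \<union> inf_often B"
  shows "\<exists>J V W U. streett_certificate P (reachable \<mu> P) A B J V W U"
proof -
  define I where "I = reachable \<mu> P"
  define V where "V s = enn2real (hit P A {} s)" for s
  have V: "ennreal (V s) = hit P A {} s" for s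
    using order_le_less_trans[OF hit_le_1[of P A "{}" s], of \<top>] by (simp add: V_def)
  have V_harm: "pmf_sum (P s) V = ennreal (V s)" if "s \<notin> A" for s
    unfolding pmf_sum_eq_nn_integral V using that by (subst (2) hit_eq) (simp add: until_step_def)
  have V_A: "V s = 1" if "s \<in> A" for s
    unfolding V_def using that by (subst hit_eq) (simp add: until_step_def)
  \<comment> \<open>\<open>C\<close> is not restricted to \<open>I\<close>, so the bound
    \<open>1/2\<close> on hitting \<open>A\<close> holds at every state outside \<open>C\<close>; on
    \<open>I\<close> it agrees with \<open>B \<union> J\<close>.\<close>
  define C where "C = B \<union> {s. V s \<le> 1/2}"
  define J where "J = {s\<in>I. V s \<le> 1/2}"
  have C_I: "s \<in> C \<longleftrightarrow> s \<in> B \<union> J" if "s \<in> I" for s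
    using that by (auto simp: C_def J_def)
  have IC: "I - (B \<union> J) = I - C" "I \<inter> (B \<union> J) = I \<inter> C" using C_I by auto
  have hitC: "ennreal (1/2) \<le> hit P A {} s" if "s \<notin> C" for s
  proof -
    have "ennreal (1/2) \<le> ennreal (V s)" using that by (intro ennreal_leI) (simp add: C_def)
    then show ?thesis by (simp only: V)
  qed
  have av: "avoid P C s = 0" if "s \<in> I" for s
    by (rule avoid_reachable_eq_0[OF ae]) (use that hitC in \<open>auto simp: C_def I_def\<close>)
  obtain W :: "'s \<Rightarrow> real" where W: "\<forall>s. 0 \<le> W s"
    "\<forall>s\<in>I - C. pmf_sum (P s) W \<le> ennreal (W s)" "\<forall>s\<in>I - C. 0 < W s"
    "\<forall>s\<in>I \<inter> C. W s = 0" "\<And>r. finite {s \<in> I - C. W s \<le> r}"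
    using recurrence_supermartingale[of I P C, OF reachable_closed[of _ \<mu> P, folded I_def] av]
    by blast
  define U where "U = steps_to P C"
  have eps: "\<exists>\<epsilon>>0. \<forall>s\<in>I - C. W s \<le> r \<longrightarrow> \<epsilon> \<le> measure_pmf.prob (P s) {s'. U s' < U s}" for r
  proof -
    let ?p = "\<lambda>s. measure_pmf.prob (P s) {s'. U s' < U s}"
    \<comment> \<open>The element \<open>1\<close> keeps the set nonempty when no state satisfies
      the conditions.\<close>
    let ?F = "insert 1 (?p ` {s \<in> I - C. W s \<le> r})"
    have fin: "finite ?F" using W(5) by simp
    have "0 < Min ?F"
      using fin av by (subst Min_gr_iff) (auto simp: U_def steps_to_decreases)
    moreover have "Min ?F \<le> ?p s" if "s \<in> I - C" "W s \<le> r" for s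
      using fin that by (intro Min_le) auto
    ultimately show ?thesis by blast
  qed
  have bdd: "bdd_above (U ` {s \<in> I. W s \<le> r})" for r
  proof -
    \<comment> \<open>States of \<open>I \<inter> C\<close> contribute only the value
      \<open>0\<close>; the others form a finite sublevel set.\<close>
    have "U ` {s \<in> I. W s \<le> r} \<subseteq> insert 0 (U ` {s \<in> I - C. W s \<le> r})"
      by (auto simp: U_def steps_to_eq_0)
    then show ?thesis
      using W(5)[of r] by (meson bdd_above_finite finite_imageI finite_insert finite_subset)
  qed
  have "\<exists>\<gamma>>0. \<forall>s\<in>J. V s \<le> 1 - \<gamma>"
    by (rule exI[of _ "1/2"]) (simp add: J_def)
  moreover have "J \<subseteq> I - A"
    using V_A by (force simp: J_def)
  moreover have "\<forall>s. 0 \<le> V s"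
    by (simp add: V_def)
  moreover have "\<forall>s\<in>I \<inter> C. U s = 0"
    by (simp add: U_def steps_to_eq_0)
  ultimately have "streett_certificate P I A B J V W U"
    unfolding streett_certificate_def IC using W(1-4) eps bdd V_harm V_A by simp
  then show ?thesis unfolding I_def by (intro exI)
qed

theorem theorem4p6:
  fixes \<mu> :: "'s::countable pmf" and P :: "'s \<Rightarrow> 's pmf"
    and k :: nat and A B :: "nat \<Rightarrow> 's set"
  assumes "measure (markov_law \<mu> P) (\<Inter>i\<in>{1..k}. fin_often (A i) \<union> inf_often (B i)) = 1"
  shows "\<exists>(I :: 's set) (V\<^sub>0 :: 's \<Rightarrow> real) (J :: nat \<Rightarrow> 's set)
           (V :: nat \<Rightarrow> 's \<Rightarrow> real) (W :: nat \<Rightarrow> 's \<Rightarrow> real) (U :: nat \<Rightarrow> 's \<Rightarrow> nat).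
      (\<forall>s. 0 \<le> V\<^sub>0 s) \<and> pmf_sum \<mu> V\<^sub>0 = 0 \<and>
      (\<forall>s\<in>I. pmf_sum (P s) V\<^sub>0 \<le> ennreal (V\<^sub>0 s)) \<and>
      (\<forall>s. s \<notin> I \<longrightarrow> 1 \<le> V\<^sub>0 s) \<and>
      (\<forall>i\<in>{1..k}.
         J i \<subseteq> I - A i \<and>
         (\<forall>s. 0 \<le> V i s) \<and> (\<forall>s. 0 \<le> W i s) \<and>
         (\<forall>s. s \<notin> A i \<longrightarrow> pmf_sum (P s) (V i) \<le> ennreal (V i s)) \<and>
         (\<forall>s\<in>A i. 1 \<le> V i s) \<and>
         (\<exists>\<gamma>>0. \<forall>s\<in>J i. V i s \<le> 1 - \<gamma>) \<and>
         (\<forall>s\<in>I - (B i \<union> J i). pmf_sum (P s) (W i) \<le> ennreal (W i s) \<and> 0 < W i s) \<and>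
         (\<forall>s\<in>I \<inter> (B i \<union> J i). W i s = 0 \<and> U i s = 0) \<and>
         (\<forall>r\<ge>0. \<exists>\<epsilon>>0. \<forall>s\<in>I - (B i \<union> J i).
            W i s \<le> r \<longrightarrow> \<epsilon> \<le> measure_pmf.prob (P s) {s'. U i s' < U i s}) \<and>
         (\<forall>r\<ge>0. bdd_above (U i ` {s \<in> I. W i s \<le> r})))"
proof -
  interpret prob_space "markov_law \<mu> P" by (rule prob_space_markov_law)
  define I where "I = reachable \<mu> P"
  have ae: "AE \<omega> in markov_law \<mu> P. \<omega> \<in> (\<Inter>i\<in>{1..k}. fin_often (A i) \<union> inf_often (B i))"
    using assms by (rule AE_prob_1)
  have "AE \<omega> in markov_law \<mu> P. \<omega> \<in> fin_often (A i) \<union> inf_often (B i)" if "i \<in> {1..k}" for i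
    using ae by eventually_elim (use that in blast)
  then have "\<forall>i\<in>{1..k}. \<exists>J V W U. streett_certificate P I (A i) (B i) J V W U"
    unfolding I_def using ex_streett_certificate by blast
  then obtain J V W U where
    "\<forall>i\<in>{1..k}. streett_certificate P I (A i) (B i) (J i) (V i) (W i) (U i)"
    unfolding bchoice_iff by blast
  note cert = this[unfolded streett_certificate_def]
  \<comment> \<open>This applies to \<open>\<mu>\<close>, supported in \<open>I\<close>, and to each
    \<open>P s\<close> with \<open>s \<in> I\<close>, because \<open>I\<close> is closed under
    transitions.\<close>
  have V0: "pmf_sum p (indicator (- I)) = 0" if "set_pmf p \<subseteq> I" for p
    unfolding pmf_sum_eq_nn_integral
    using that by (subst nn_integral_0_iff_AE) (auto simp: AE_measure_pmf_iff)
  have "pmf_sum \<mu> (indicator (- I)) = 0"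
    by (rule V0) (simp add: I_def set_pmf_subset_reachable)
  moreover have "\<forall>s\<in>I. pmf_sum (P s) (indicator (- I)) \<le> ennreal (indicator (- I) s)"
    using V0 by (simp add: I_def reachable_closed)
  moreover have "\<forall>s. 0 \<le> (indicator (- I) s :: real)" "\<forall>s. s \<notin> I \<longrightarrow> 1 \<le> (indicator (- I) s :: real)"
    by simp_all
  ultimately show ?thesis
    using cert
    by (intro exI[of _ I] exI[of _ "indicator (- I)"] exI[of _ J] exI[of _ V] exI[of _ W]
        exI[of _ U] conjI)
qed

end
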